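(* Let $U\neq\emptyset$ be an open semi-algebraic and relatively compact subset of $Q=(\mathbb{R}_+^* )^n\subseteq T(\mathbb{R})$, let $v\in N$, and let $$S=S_v(U)=\{\lambda_v(s)\xi:\xi\in U,\ 0<s\le1\}$$ be the associated $v$-tentacle. Let $\sigma$ be a pointed cone in $N_{\mathbb{R}}$. Then the ring $B_{U_\sigma}(S)$ of regular functions on $U_\sigma$ that are bounded on $S$ is $$B_{U_\sigma}(S)=\mathbb{R}[H],\qquad H=M\cap\sigma^*\cap(\mathbb{R}_+v)^*.$$
   Context: $T$ is the $n$-dimensional split torus over $\mathbb{R}$ with $T(\mathbb{R})=(\mathbb{R}^* )^n$; $M=\mathrm{Hom}(T,\mathbb{G}_m)=\mathbb{Z}^n$ is its character group, $N=\mathrm{Hom}(\mathbb{G}_m,T)=\mathbb{Z}^n$ its co-character group, with natural pairing $\langle\alpha,v\rangle$. For $v\in N$, $\lambda_v$ is the corresponding co-character, $\lambda_v(s)=(s^{v_1},\dots,s^{v_n})$. $M_{\mathbb{R}}=M\otimes\mathbb{R}$, $N_{\mathbb{R}}=N\otimes\mathbb{R}$. $Q=(\mathbb{R}_+^* )^n$ is the open positive orthant; "relatively compact in $Q$" means that the closure in $Q$ is compact. A cone in $N_{\mathbb{R}}$ always means a finitely generated rational convex cone; it is pointed if it contains no line. For a cone $\rho$, $\rho^*=\{\alpha\in M_{\mathbb{R}}:\langle\alpha,w\rangle\ge0\ \forall w\in\rho\}$; $\mathbb{R}_+v$ is the cone of non-negative real multiples of $v$. $U_\sigma=\mathrm{Spec}\,\mathbb{R}[M\cap\sigma^*]$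 is the affine toric variety of $\sigma$ (spectrum of the semigroup algebra); its dense torus orbit is identified with $T$, so $S\subseteq T(\mathbb{R})\subseteq U_\sigma(\mathbb{R})$. $\mathbb{R}[H]$ is the semigroup algebra of $H$, viewed inside $\mathbb{R}[U_\sigma]$. *)

theory Defs
  imports "HOL-Analysis.Analysis" "HOL-Library.Poly_Mapping"
begin

text \<open>
  The character lattice \<open>M\<close> and the co-character lattice \<open>N\<close> of the split torus \<open>T\<close> are both
  represented by the type \<open>int ^ 'n\<close>, and \<open>M\<close> and \<open>N\<close> tensored with the reals by \<open>real ^ 'n\<close>.
  The pairing of the latter is the inner product.
\<close>

definition real_vec :: "int ^ 'n \<Rightarrow> real ^ 'n" where
  "real_vec a = (\<chi> i. real_of_int (a $ i))"

definition lattice_points :: "(real ^ 'n) set \<Rightarrow> (int ^ 'n) set" where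
  "lattice_points C = {\<alpha>. real_vec \<alpha> \<in> C}"


subsection \<open>Cones\<close>

definition rational_cone :: "(real ^ 'n) set \<Rightarrow> bool" where
  "rational_cone \<sigma> \<longleftrightarrow> (\<exists>F :: (int ^ 'n) set. finite F \<and> \<sigma> = convex_cone hull (real_vec ` F))"

definition pointed :: "'a::real_vector set \<Rightarrow> bool" where
  "pointed \<sigma> \<longleftrightarrow> \<not> (\<exists>a d. d \<noteq> 0 \<and> (\<forall>t::real. a + t *\<^sub>R d \<in> \<sigma>))"

definition dual_cone :: "'a::real_inner set \<Rightarrow> 'a set" where
  "dual_cone \<rho> = {\<alpha>. \<forall>w\<in>\<rho>. 0 \<le> \<alpha> \<bullet> w}"

definition ray :: "int ^ 'n \<Rightarrow> (real ^ 'n) set" where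
  "ray v = {t *\<^sub>R real_vec v | t. 0 \<le> t}"


subsection \<open>The torus\<close>

definition torus :: "(real ^ 'n) set" where
  "torus = {\<xi>. \<forall>i. \<xi> $ i \<noteq> 0}"

definition positive_orthant :: "(real ^ 'n) set" where
  "positive_orthant = {\<xi>. \<forall>i. 0 < \<xi> $ i}"

definition torus_character :: "int ^ 'n \<Rightarrow> real ^ 'n \<Rightarrow> real" where
  "torus_character \<alpha> \<xi> = (\<Prod>i\<in>UNIV. (\<xi> $ i) powi (\<alpha> $ i))"

definition cocharacter :: "int ^ 'n \<Rightarrow> real \<Rightarrow> real ^ 'n" where
  "cocharacter v s = (\<chi> i. s powi (v $ i))"

text \<open>Multiplication on \<open>real ^ 'n\<close> is componentwise, so it is the group law of the torus.\<close>

definition tentacle :: "int ^ 'n \<Rightarrow> (real ^ 'n) set \<Rightarrow> (real ^ 'n) set" where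
  "tentacle v U = {cocharacter v s * \<xi> | s \<xi>. \<xi> \<in> U \<and> 0 < s \<and> s \<le> 1}"


subsection \<open>Semi-algebraic and relatively compact sets\<close>

text \<open>
  The Boolean algebra of sets generated by the sets \<open>p > 0\<close> with \<open>p\<close> a polynomial. On a
  Euclidean space every linear function is bounded, so \<^const>\<open>real_polynomial_function\<close> describes
  exactly the polynomials in the coordinates. Using Laurent polynomials on the torus instead
  gives the same subsets of the torus.
\<close>

inductive semialgebraic :: "'a::euclidean_space set \<Rightarrow> bool" where
  positivity: "real_polynomial_function p \<Longrightarrow> semialgebraic {x. 0 < p x}"
| complement: "semialgebraic A \<Longrightarrow> semialgebraic (- A)"
| union: "semialgebraic A \<Longrightarrow> semialgebraic B \<Longrightarrow> semialgebraic (A \<union> B)"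

text \<open>The closure is taken in the subspace \<open>Y\<close>, not in the ambient space.\<close>

definition relatively_compact_in :: "'a::topological_space set \<Rightarrow> 'a set \<Rightarrow> bool" where
  "relatively_compact_in Y U \<longleftrightarrow>
     U \<subseteq> Y \<and> compactin (top_of_set Y) (top_of_set Y closure_of U)"


subsection \<open>Affine toric varieties\<close>

text \<open>
  The type \<open>(int ^ 'n) \<Rightarrow>\<^sub>0 real\<close> with its convolution product is the group algebra of \<open>M\<close> over
  the reals. The algebra of a sub-semigroup \<open>H\<close> consists of the elements supported on \<open>H\<close>.
\<close>

definition semigroup_algebra :: "(int ^ 'n) set \<Rightarrow> ((int ^ 'n) \<Rightarrow>\<^sub>0 real) set" where
  "semigroup_algebra H = {f. Poly_Mapping.keys f \<subseteq> H}"

text \<open>The ring of regular functions on the affine variety \<open>U_\<sigma>\<close>.\<close>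

definition coordinate_ring :: "(real ^ 'n) set \<Rightarrow> ((int ^ 'n) \<Rightarrow>\<^sub>0 real) set" where
  "coordinate_ring \<sigma> = semigroup_algebra (lattice_points (dual_cone \<sigma>))"

text \<open>
  A real point of \<open>U_\<sigma>\<close> is a homomorphism of real algebras from the coordinate ring to the reals
  (made \<^const>\<open>undefined\<close> outside the coordinate ring); the value of a regular function \<open>f\<close>
  at a point \<open>\<phi>\<close> is \<open>\<phi> f\<close>.
\<close>

definition real_points :: "(real ^ 'n) set \<Rightarrow> (((int ^ 'n) \<Rightarrow>\<^sub>0 real) \<Rightarrow> real) set" where
  "real_points \<sigma> = {\<phi> \<in> extensional (coordinate_ring \<sigma>).
     (\<forall>c. \<phi> (Poly_Mapping.single 0 c) = c) \<and>
     (\<forall>f\<in>coordinate_ring \<sigma>. \<forall>g\<in>coordinate_ring \<sigma>.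
        \<phi> (f + g) = \<phi> f + \<phi> g \<and> \<phi> (f * g) = \<phi> f * \<phi> g)}"

definition laurent_eval :: "((int ^ 'n) \<Rightarrow>\<^sub>0 real) \<Rightarrow> real ^ 'n \<Rightarrow> real" where
  "laurent_eval f \<xi> =
     (\<Sum>\<alpha>\<in>Poly_Mapping.keys f. Poly_Mapping.lookup f \<alpha> * torus_character \<alpha> \<xi>)"

text \<open>The inclusion of the dense torus into \<open>U_\<sigma>\<close>, on real points.\<close>

definition torus_point ::
    "(real ^ 'n) set \<Rightarrow> real ^ 'n \<Rightarrow> ((int ^ 'n) \<Rightarrow>\<^sub>0 real) \<Rightarrow> real" where
  "torus_point \<sigma> \<xi> = restrict (\<lambda>f. laurent_eval f \<xi>) (coordinate_ring \<sigma>)"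

text \<open>For a set \<open>S\<close> of real points of \<open>U_\<sigma>\<close>, the regular functions on \<open>U_\<sigma>\<close> bounded on \<open>S\<close>.\<close>

definition bounded_functions ::
    "(real ^ 'n) set \<Rightarrow> (((int ^ 'n) \<Rightarrow>\<^sub>0 real) \<Rightarrow> real) set \<Rightarrow> ((int ^ 'n) \<Rightarrow>\<^sub>0 real) set" where
  "bounded_functions \<sigma> S = {f \<in> coordinate_ring \<sigma>. bounded ((\<lambda>\<phi>. \<phi> f) ` S)}"


subsection \<open>Consistency of the definitions\<close>

lemma tentacle_subset_torus:
  assumes "U \<subseteq> torus"
  shows "tentacle v U \<subseteq> torus"
  using assms by (fastforce simp: tentacle_def torus_def cocharacter_def)

lemma semigroup_algebra_add:
  "f \<in> semigroup_algebra H \<Longrightarrow> g \<in> semigroup_algebra H \<Longrightarrow> f + g \<in> semigroup_algebra H"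
  using keys_add[of f g] by (auto simp: semigroup_algebra_def)

lemma coordinate_ring_add:
  "f \<in> coordinate_ring \<sigma> \<Longrightarrow> g \<in> coordinate_ring \<sigma> \<Longrightarrow> f + g \<in> coordinate_ring \<sigma>"
  by (simp add: coordinate_ring_def semigroup_algebra_add)

lemma coordinate_ring_mult:
  fixes \<sigma> :: "(real ^ 'n) set"
  assumes "f \<in> coordinate_ring \<sigma>" "g \<in> coordinate_ring \<sigma>"
  shows "f * g \<in> coordinate_ring \<sigma>"
proof -
  have "real_vec (a + b) = real_vec a + real_vec b" for a b :: "int ^ 'n"
    by (simp add: real_vec_def vec_eq_iff)
  then have "a + b \<in> lattice_points (dual_cone \<sigma>)"
    if "a \<in> lattice_points (dual_cone \<sigma>)" "b \<in> lattice_points (dual_cone \<sigma>)" for a b :: "int ^ 'n"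
    using that by (simp add: lattice_points_def dual_cone_def inner_add_left)
  then show ?thesis
    using assms keys_mult[of f g] unfolding coordinate_ring_def semigroup_algebra_def by blast
qed

lemma coordinate_ring_single_0:
  fixes \<sigma> :: "(real ^ 'n) set"
  shows "Poly_Mapping.single 0 c \<in> coordinate_ring \<sigma>"
proof -
  have "real_vec (0 :: int ^ 'n) = 0"
    by (simp add: real_vec_def vec_eq_iff)
  then show ?thesis
    by (auto simp: coordinate_ring_def semigroup_algebra_def lattice_points_def dual_cone_def)
qed

lemma laurent_eval_superset:
  assumes "finite A" "Poly_Mapping.keys f \<subseteq> A"
  shows "laurent_eval f \<xi> = (\<Sum>\<alpha>\<in>A. Poly_Mapping.lookup f \<alpha> * torus_character \<alpha> \<xi>)"
  unfolding laurent_eval_def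
  by (rule sum.mono_neutral_left) (use assms in \<open>auto simp: in_keys_iff\<close>)

lemma laurent_eval_add: "laurent_eval (f + g) \<xi> = laurent_eval f \<xi> + laurent_eval g \<xi>"
proof -
  let ?A = "Poly_Mapping.keys f \<union> Poly_Mapping.keys g"
  have "laurent_eval h \<xi> = (\<Sum>\<alpha>\<in>?A. Poly_Mapping.lookup h \<alpha> * torus_character \<alpha> \<xi>)"
    if "h \<in> {f, g, f + g}" for h
    using that keys_add[of f g] by (intro laurent_eval_superset) auto
  then show ?thesis
    by (simp add: lookup_add distrib_right sum.distrib)
qed

lemma laurent_eval_single:
  "laurent_eval (Poly_Mapping.single \<alpha> c) \<xi> = c * torus_character \<alpha> \<xi>"
  by (simp add: laurent_eval_def)

lemma torus_character_add:
  "\<xi> \<in> torus \<Longrightarrow>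
     torus_character (\<alpha> + \<beta>) \<xi> = torus_character \<alpha> \<xi> * torus_character \<beta> \<xi>"
  by (simp add: torus_character_def torus_def power_int_add prod.distrib)

lemma laurent_eval_sum:
  "finite I \<Longrightarrow> laurent_eval (\<Sum>i\<in>I. f i) \<xi> = (\<Sum>i\<in>I. laurent_eval (f i) \<xi>)"
proof (induction I rule: finite_induct)
  case empty
  then show ?case by (simp add: laurent_eval_def)
qed (simp add: laurent_eval_add)

lemma laurent_eval_mult:
  fixes \<xi> :: "real ^ 'n"
  assumes "\<xi> \<in> torus"
  shows "laurent_eval (f * g) \<xi> = laurent_eval f \<xi> * laurent_eval g \<xi>"
proof -
  have eq: "h = (\<Sum>\<alpha>\<in>Poly_Mapping.keys h. Poly_Mapping.single \<alpha> (Poly_Mapping.lookup h \<alpha>))"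
    for h :: "(int ^ 'n) \<Rightarrow>\<^sub>0 real"
    by (rule poly_mapping_eqI) (simp add: lookup_sum lookup_single when_def in_keys_iff)
  have "f * g = (\<Sum>\<alpha>\<in>Poly_Mapping.keys f. \<Sum>\<beta>\<in>Poly_Mapping.keys g.
      Poly_Mapping.single (\<alpha> + \<beta>) (Poly_Mapping.lookup f \<alpha> * Poly_Mapping.lookup g \<beta>))"
    by (subst eq[of f], subst eq[of g]) (simp add: sum_product mult_single)
  then have "laurent_eval (f * g) \<xi> = (\<Sum>\<alpha>\<in>Poly_Mapping.keys f. \<Sum>\<beta>\<in>Poly_Mapping.keys g.
      Poly_Mapping.lookup f \<alpha> * Poly_Mapping.lookup g \<beta> * torus_character (\<alpha> + \<beta>) \<xi>)"
    by (simp add: laurent_eval_sum laurent_eval_single)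
  then show ?thesis
    by (simp add: torus_character_add[OF assms] laurent_eval_def sum_product mult_ac)
qed

lemma torus_point_in_real_points:
  assumes "\<xi> \<in> torus"
  shows "torus_point \<sigma> \<xi> \<in> real_points \<sigma>"
  using assms
  by (simp add: torus_point_def real_points_def coordinate_ring_single_0 coordinate_ring_add
      coordinate_ring_mult laurent_eval_add laurent_eval_mult laurent_eval_single
      torus_character_def)

end

theory Submission
  imports Defs
begin

text \<open>
  A character \<open>\<chi>\<^sup>\<alpha>\<close> satisfies \<open>\<chi>\<^sup>\<alpha>(\<lambda>\<^sub>v(s) \<xi>) = s\<^bsup>\<langle>\<alpha>,v\<rangle>\<^esup> \<chi>\<^sup>\<alpha>(\<xi>)\<close>, so it is bounded on the tentacle
  if \<open>\<langle>\<alpha>,v\<rangle> \<ge> 0\<close>. Conversely, if \<open>f\<close> is bounded on the tentacle and the least weight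
  \<open>k = \<langle>\<alpha>,v\<rangle>\<close> of its monomials is negative, then multiplying \<open>f(\<lambda>\<^sub>v(s) \<xi>)\<close> by \<open>s\<^bsup>-k\<^esup>\<close> and letting
  \<open>s\<close> tend to \<open>0\<close> shows that the weight \<open>k\<close> part of \<open>f\<close> vanishes at every \<open>\<xi> \<in> U\<close>. This
  contradicts the linear independence of characters on a nonempty open set.
\<close>

text \<open>Integer-valued, so that it can serve as an exponent of \<open>powi\<close>;
  \<open>inner_real_vec\<close> relates it to the real inner product used in the dual cones.\<close>

definition pairing :: "int ^ 'n \<Rightarrow> int ^ 'n \<Rightarrow> int" where
  "pairing \<alpha> v = (\<Sum>i\<in>UNIV. \<alpha> $ i * v $ i)"

lemma inner_real_vec: "real_vec \<alpha> \<bullet> real_vec v = real_of_int (pairing \<alpha> v)"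
  by (simp add: real_vec_def inner_vec_def pairing_def)

text \<open>Weights along the standard co-characters are the coordinates of \<alpha>, so these
  co-characters together separate distinct characters.\<close>

lemma pairing_axis: "pairing \<alpha> (axis i 1) = \<alpha> $ i"
  by (simp add: pairing_def axis_def if_distrib cong: if_cong)

lemma real_vec_in_dual_cone_ray: "real_vec \<alpha> \<in> dual_cone (ray v) \<longleftrightarrow> 0 \<le> pairing \<alpha> v"
proof
  assume *: "real_vec \<alpha> \<in> dual_cone (ray v)"
  have "real_vec v \<in> ray v"
    unfolding ray_def by (rule CollectI, rule exI[of _ 1]) simp
  with * show "0 \<le> pairing \<alpha> v"
    by (auto simp: dual_cone_def inner_real_vec)
qed (auto simp: dual_cone_def ray_def inner_real_vec)

lemma prod_powi: "s \<noteq> 0 \<Longrightarrow> (\<Prod>i\<in>A. s powi f i) = s powi (\<Sum>i\<in>A. f i)"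
  for s :: "'a::field"
  by (induction A rule: infinite_finite_induct) (auto simp: power_int_add)

lemma torus_character_cocharacter:
  assumes "s \<noteq> 0"
  shows "torus_character \<alpha> (cocharacter v s * \<xi>) = s powi pairing \<alpha> v * torus_character \<alpha> \<xi>"
proof -
  have "torus_character \<alpha> (cocharacter v s * \<xi>)
      = (\<Prod>i\<in>UNIV. s powi (\<alpha> $ i * v $ i)) * torus_character \<alpha> \<xi>"
    by (simp add: torus_character_def cocharacter_def power_int_mult_distrib prod.distrib
        flip: power_int_mult) (simp add: mult.commute)
  then show ?thesis
    by (simp add: prod_powi[OF assms] pairing_def)
qed

lemma torus_character_nonzero: "\<xi> \<in> torus \<Longrightarrow> torus_character \<alpha> \<xi> \<noteq> 0"
  by (simp add: torus_character_def torus_def)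

lemma continuous_on_torus_character: "continuous_on torus (torus_character \<alpha>)"
  unfolding torus_character_def torus_def by (intro continuous_intros) auto

lemma positive_orthant_subset_torus: "positive_orthant \<subseteq> torus"
  by (auto simp: positive_orthant_def torus_def) (metis less_irrefl)

text \<open>The closure of \<open>U\<close> in \<open>Y\<close> is compact and stays inside
  \<open>Y\<close>, where \<open>f\<close> is continuous. This applies to characters with negative
  exponents, which blow up towards the boundary of the orthant.\<close>

lemma bounded_continuous_image_relatively_compact:
  fixes f :: "'a::topological_space \<Rightarrow> 'b::metric_space"
  assumes "relatively_compact_in Y U" "continuous_on Y f"
  shows "bounded (f ` U)"
proof -
  let ?K = "top_of_set Y closure_of U"
  have K: "compact ?K" "?K \<subseteq> Y" and U: "U \<subseteq> ?K"
    using assms(1) closure_of_subset[of U "top_of_set Y"]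
    by (auto simp: relatively_compact_in_def compactin_subtopology)
  then have "bounded (f ` ?K)"
    using assms(2) by (meson compact_continuous_image compact_imp_bounded continuous_on_subset)
  then show ?thesis
    using U by (meson bounded_subset image_mono)
qed

text \<open>
  Differentiating along \<open>s \<mapsto> \<lambda>\<^sub>v(s) \<xi>\<close> at \<open>s = 1\<close> multiplies the coefficient of \<open>\<chi>\<^sup>\<alpha>\<close> by
  \<open>\<langle>\<alpha>,v\<rangle>\<close>.
\<close>

lemma character_sum_weighted_eq_0:
  fixes U :: "(real ^ 'n) set"
  assumes "open U" and zero: "\<And>\<xi>. \<xi> \<in> U \<Longrightarrow> (\<Sum>\<alpha>\<in>A. c \<alpha> * torus_character \<alpha> \<xi>) = 0"
    and "\<xi> \<in> U"
  shows "(\<Sum>\<alpha>\<in>A. of_int (pairing \<alpha> v) * c \<alpha> * torus_character \<alpha> \<xi>) = 0"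
proof -
  \<comment> \<open>For \<open>s \<noteq> 0\<close> this is the character sum at
    \<open>cocharacter v s * \<xi>\<close>. Since \<open>U\<close> is open, that point stays in
    \<open>U\<close> for \<open>s\<close> near 1, so \<open>?g\<close> vanishes near 1 and its
    derivative at 1 can be computed in two ways.\<close>
  let ?g = "\<lambda>s::real. \<Sum>\<alpha>\<in>A. c \<alpha> * (s powi pairing \<alpha> v * torus_character \<alpha> \<xi>)"
  have [simp]: "cocharacter v 1 = 1"
    by (simp add: cocharacter_def vec_eq_iff)
  have "isCont (\<lambda>s. cocharacter v s * \<xi>) 1"
    unfolding isCont_def
    by (rule vec_tendstoI) (auto simp: cocharacter_def intro!: tendsto_eq_intros)
  then have "((\<lambda>s. cocharacter v s * \<xi>) \<longlongrightarrow> \<xi>) (nhds 1)"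
    by (simp add: continuous_at tendsto_nhds_iff)
  then have "\<forall>\<^sub>F s in nhds 1. cocharacter v s * \<xi> \<in> U"
    using assms(1,3) by (rule topological_tendstoD)
  moreover have "\<forall>\<^sub>F s::real in nhds 1. s \<noteq> 0"
    by (rule t1_space_nhds) simp
  ultimately have "\<forall>\<^sub>F s in nhds 1. ?g s = 0"
  proof eventually_elim
    case (elim s)
    then show ?case
      using zero[of "cocharacter v s * \<xi>"] by (simp add: torus_character_cocharacter)
  qed
  then have "(?g has_real_derivative 0) (at 1)"
    by (subst DERIV_cong_ev[OF refl _ refl, of _ "\<lambda>_. 0"]) auto
  moreover have "(?g has_real_derivative
      (\<Sum>\<alpha>\<in>A. of_int (pairing \<alpha> v) * c \<alpha> * torus_character \<alpha> \<xi>)) (at 1)"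
    by (auto intro!: derivative_eq_intros sum.cong)
  ultimately show ?thesis
    using DERIV_unique by blast
qed

text \<open>Induction that shortens a relation: subtracting \<open>a $ i\<close> times the relation
  from its derivative along \<open>axis i 1\<close> removes the term of \<open>a\<close> and
  multiplies the coefficient of each other \<beta> by \<open>\<beta> $ i - a $ i\<close>.\<close>

lemma characters_linearly_independent:
  fixes U :: "(real ^ 'n) set"
  assumes U: "open U" "U \<noteq> {}" "U \<subseteq> torus" and "finite A"
    and "\<And>\<xi>. \<xi> \<in> U \<Longrightarrow> (\<Sum>\<alpha>\<in>A. c \<alpha> * torus_character \<alpha> \<xi>) = 0"
  shows "\<forall>\<alpha>\<in>A. c \<alpha> = 0"
  using assms(4,5)
proof (induction A arbitrary: c rule: finite_induct)
  case (insert a A)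
  have "c \<alpha> = 0" if "\<alpha> \<in> A" for \<alpha>
  proof -
    \<comment> \<open>With this choice of \<open>i\<close> the factor
      \<open>\<alpha> $ i - a $ i\<close> is nonzero, so the shortened relation forces
      \<open>c \<alpha> = 0\<close>.\<close>
    from insert.hyps that obtain i where i: "\<alpha> $ i \<noteq> a $ i"
      by (metis vec_eq_iff)
    have "(\<Sum>\<beta>\<in>A. (of_int (\<beta> $ i - a $ i) * c \<beta>) * torus_character \<beta> \<xi>) = 0"
      if "\<xi> \<in> U" for \<xi>
    proof -
      have "(\<Sum>\<beta>\<in>insert a A. of_int (\<beta> $ i) * c \<beta> * torus_character \<beta> \<xi>) = 0"
        using character_sum_weighted_eq_0[OF U(1) insert.prems that, of "axis i 1"]
        by (simp add: pairing_axis)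
      moreover have "of_int (a $ i) * (\<Sum>\<beta>\<in>insert a A. c \<beta> * torus_character \<beta> \<xi>) = 0"
        using insert.prems[OF that] by simp
      ultimately show ?thesis
        using insert.hyps
        by (simp add: algebra_simps sum_subtractf sum_distrib_left)
    qed
    from insert.IH[OF this] i \<open>\<alpha> \<in> A\<close> show ?thesis
      by auto
  qed
  \<comment> \<open>Only the term of \<open>a\<close> is left in the relation; evaluating at one
    point of \<open>U\<close> suffices because characters have no zeros on the torus.\<close>
  moreover from this obtain \<xi> where "\<xi> \<in> U" "c a * torus_character a \<xi> = 0"
    using insert U(2) by fastforce
  ultimately show ?case
    using U(3) torus_character_nonzero by auto
qed simp

text \<open>A bound for a character on \<open>U\<close> persists on the tentacle when its weight is
  nonnegative, as the factor \<open>s powi pairing \<alpha> v\<close> is then at most 1. The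
  triangle inequality sums these bounds.\<close>

lemma bounded_laurent_eval_tentacle:
  assumes "U \<subseteq> positive_orthant" "relatively_compact_in positive_orthant U"
    and nonneg: "\<And>\<alpha>. \<alpha> \<in> Poly_Mapping.keys f \<Longrightarrow> 0 \<le> pairing \<alpha> v"
  shows "bounded (laurent_eval f ` tentacle v U)"
proof -
  have "\<exists>B. \<forall>\<xi>\<in>U. \<bar>torus_character \<alpha> \<xi>\<bar> \<le> B" for \<alpha>
  proof -
    have "bounded (torus_character \<alpha> ` U)"
      using assms(2) continuous_on_torus_character positive_orthant_subset_torus
      by (intro bounded_continuous_image_relatively_compact) (auto intro: continuous_on_subset)
    then show ?thesis
      by (auto simp: bounded_iff)
  qed
  then obtain B where B: "\<bar>torus_character \<alpha> \<xi>\<bar> \<le> B \<alpha>" if "\<xi> \<in> U" for \<alpha> \<xi>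
    by metis
  have "\<bar>laurent_eval f (cocharacter v s * \<xi>)\<bar>
      \<le> (\<Sum>\<alpha>\<in>Poly_Mapping.keys f. \<bar>Poly_Mapping.lookup f \<alpha>\<bar> * B \<alpha>)"
    if "\<xi> \<in> U" "0 < s" "s \<le> 1" for s \<xi>
  proof -
    have "\<bar>torus_character \<alpha> (cocharacter v s * \<xi>)\<bar> \<le> B \<alpha>" if "\<alpha> \<in> Poly_Mapping.keys f" for \<alpha>
    proof -
      have "s powi pairing \<alpha> v \<le> 1"
        using \<open>0 < s\<close> \<open>s \<le> 1\<close> nonneg[OF that] by (simp add: power_int_def power_le_one)
      then have "s powi pairing \<alpha> v * \<bar>torus_character \<alpha> \<xi>\<bar> \<le> 1 * B \<alpha>"
        using \<open>0 < s\<close> B[OF \<open>\<xi> \<in> U\<close>, of \<alpha>] by (intro mult_mono) auto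
      then show ?thesis
        using \<open>0 < s\<close> by (simp add: torus_character_cocharacter abs_mult)
    qed
    then show ?thesis
      unfolding laurent_eval_def
      by (intro order_trans[OF sum_abs] sum_mono) (auto simp: abs_mult intro: mult_left_mono)
  qed
  then show ?thesis
    unfolding bounded_iff tentacle_def by auto
qed

lemma lowest_weight_part_eq_0:
  fixes v :: "int ^ 'n"
  assumes bdd: "bounded (laurent_eval f ` tentacle v U)" and "\<xi> \<in> U" and "k < 0"
    and least: "\<And>\<alpha>. \<alpha> \<in> Poly_Mapping.keys f \<Longrightarrow> k \<le> pairing \<alpha> v"
  shows "(\<Sum>\<alpha>\<in>{\<alpha> \<in> Poly_Mapping.keys f. pairing \<alpha> v = k}.
    Poly_Mapping.lookup f \<alpha> * torus_character \<alpha> \<xi>) = 0"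
proof -
  let ?t = "\<lambda>\<alpha>. Poly_Mapping.lookup f \<alpha> * torus_character \<alpha> \<xi>"
  \<comment> \<open>The exponent \<open>- k\<close> is positive, so boundedness on the tentacle
    forces the limit 0; it also clears every negative power of \<open>s\<close>, so the limit can be
    read off term by term.\<close>
  let ?g = "\<lambda>s. s ^ nat (- k) * laurent_eval f (cocharacter v s * \<xi>)"
  have pos: "\<forall>\<^sub>F s::real in at_right 0. 0 < s \<and> s \<le> 1"
    using eventually_at_right_less[of 0] eventually_at_rightI[of 0 1 "\<lambda>s::real. s \<le> 1"]
    by (auto intro: eventually_conj)
  obtain B where "\<bar>y\<bar> \<le> B" if "y \<in> laurent_eval f ` tentacle v U" for y
    using bdd by (auto simp: bounded_iff)
  then have B: "\<bar>laurent_eval f (cocharacter v s * \<xi>)\<bar> \<le> B" if "0 < s" "s \<le> 1" for s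
    using that \<open>\<xi> \<in> U\<close> by (auto simp: tentacle_def)
  have "(?g \<longlongrightarrow> 0) (at_right 0)"
  proof (rule Lim_null_comparison)
    show "((\<lambda>s::real. s ^ nat (- k) * B) \<longlongrightarrow> 0) (at_right 0)"
      using \<open>k < 0\<close> by (auto intro!: tendsto_eq_intros)
    show "\<forall>\<^sub>F s in at_right 0. norm (?g s) \<le> s ^ nat (- k) * B"
      using pos by eventually_elim (auto simp: abs_mult intro!: mult_left_mono B)
  qed
  moreover have "(?g \<longlongrightarrow> (\<Sum>\<alpha>\<in>Poly_Mapping.keys f. (if pairing \<alpha> v = k then 1 else 0) * ?t \<alpha>))
    (at_right 0)"
  proof (rule Lim_transform_eventually)
    show "((\<lambda>s::real. \<Sum>\<alpha>\<in>Poly_Mapping.keys f. s ^ nat (pairing \<alpha> v - k) * ?t \<alpha>)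
      \<longlongrightarrow> (\<Sum>\<alpha>\<in>Poly_Mapping.keys f. (if pairing \<alpha> v = k then 1 else 0) * ?t \<alpha>)) (at_right 0)"
    proof (intro tendsto_sum tendsto_mult_right)
      fix \<alpha> assume "\<alpha> \<in> Poly_Mapping.keys f"
      \<comment> \<open>The exponent is 0 exactly for the terms of weight \<open>k\<close>, which
        survive; all other exponents are positive.\<close>
      with least show "((\<lambda>s::real. s ^ nat (pairing \<alpha> v - k)) \<longlongrightarrow>
          (if pairing \<alpha> v = k then 1 else 0)) (at_right 0)"
        by (force intro!: tendsto_eq_intros simp: order_less_le)
    qed
    show "\<forall>\<^sub>F s in at_right 0.
      (\<Sum>\<alpha>\<in>Poly_Mapping.keys f. s ^ nat (pairing \<alpha> v - k) * ?t \<alpha>) = ?g s"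
      using pos
    proof eventually_elim
      case (elim s)
      have "s ^ nat (pairing \<alpha> v - k) = s ^ nat (- k) * s powi pairing \<alpha> v"
        if "\<alpha> \<in> Poly_Mapping.keys f" for \<alpha>
      proof -
        have "s ^ nat (pairing \<alpha> v - k) = s powi (- k + pairing \<alpha> v)"
          using least[OF that] by (simp add: power_int_def)
        also have "\<dots> = s ^ nat (- k) * s powi pairing \<alpha> v"
          using elim \<open>k < 0\<close> by (subst power_int_add) (auto simp: power_int_def)
        finally show ?thesis .
      qed
      then have "(\<Sum>\<alpha>\<in>Poly_Mapping.keys f. s ^ nat (pairing \<alpha> v - k) * ?t \<alpha>)
          = (\<Sum>\<alpha>\<in>Poly_Mapping.keys f. s ^ nat (- k) * s powi pairing \<alpha> v * ?t \<alpha>)"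
        by (intro sum.cong refl) simp
      also have "\<dots> = ?g s"
        using elim
        by (simp add: laurent_eval_def torus_character_cocharacter sum_distrib_left mult.assoc
            mult.left_commute[of "s powi _"])
      finally show ?case .
    qed
  qed
  ultimately have "0 = (\<Sum>\<alpha>\<in>Poly_Mapping.keys f. (if pairing \<alpha> v = k then 1 else 0) * ?t \<alpha>)"
    by (rule tendsto_unique[OF trivial_limit_at_right_real])
  moreover have "(\<Sum>\<alpha>\<in>{\<alpha> \<in> Poly_Mapping.keys f. pairing \<alpha> v = k}. ?t \<alpha>)
      = (\<Sum>\<alpha>\<in>Poly_Mapping.keys f. (if pairing \<alpha> v = k then 1 else 0) * ?t \<alpha>)"
    by (rule sum.mono_neutral_cong_left) auto
  ultimately show ?thesis
    by simp
qed

lemma pairing_nonneg_if_bounded: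
  fixes U :: "(real ^ 'n) set"
  assumes U: "open U" "U \<noteq> {}" "U \<subseteq> torus"
    and bdd: "bounded (laurent_eval f ` tentacle v U)" and "\<alpha> \<in> Poly_Mapping.keys f"
  shows "0 \<le> pairing \<alpha> v"
proof (rule ccontr)
  let ?W = "(\<lambda>\<alpha>. pairing \<alpha> v) ` Poly_Mapping.keys f"
  let ?A = "{\<alpha> \<in> Poly_Mapping.keys f. pairing \<alpha> v = Min ?W}"
  assume neg: "\<not> 0 \<le> pairing \<alpha> v"
  have "Min ?W \<le> pairing \<alpha> v"
    using assms(5) by simp
  with neg have "Min ?W < 0"
    by simp
  then have "\<forall>\<beta>\<in>?A. Poly_Mapping.lookup f \<beta> = 0"
    by (intro characters_linearly_independent[OF U] lowest_weight_part_eq_0[OF bdd]) auto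
  \<comment> \<open>The minimum is attained, so \<open>?A\<close> contains a key of
    \<open>f\<close>, whose coefficient cannot be 0.\<close>
  moreover have "Min ?W \<in> ?W"
    using assms(5) by (intro Min_in) auto
  ultimately show False
    by (auto simp: in_keys_iff)
qed

theorem corollary2p20:
  fixes U :: "(real ^ 'n) set" and v :: "int ^ 'n" and \<sigma> :: "(real ^ 'n) set"
  assumes "U \<noteq> {}" and "open U" and "semialgebraic U"
    and "U \<subseteq> positive_orthant" and "relatively_compact_in positive_orthant U"
    and "rational_cone \<sigma>" and "pointed \<sigma>"
  shows "bounded_functions \<sigma> (torus_point \<sigma> ` tentacle v U) =
    semigroup_algebra (lattice_points (dual_cone \<sigma> \<inter> dual_cone (ray v)))"
proof -
  have "bounded (laurent_eval f ` tentacle v U) \<longleftrightarrow> (\<forall>\<alpha>\<in>Poly_Mapping.keys f. 0 \<le> pairing \<alpha> v)"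
    for f
    using bounded_laurent_eval_tentacle[OF assms(4,5)] assms(4) positive_orthant_subset_torus
      pairing_nonneg_if_bounded[OF assms(2,1)]
    by blast
  \<comment> \<open>On the coordinate ring the restriction in \<open>torus_point\<close> has no
    effect, so boundedness over real points becomes boundedness of the Laurent polynomial.\<close>
  moreover have "(\<lambda>\<phi>. \<phi> f) ` torus_point \<sigma> ` tentacle v U = laurent_eval f ` tentacle v U"
    if "f \<in> coordinate_ring \<sigma>" for f
    using that by (auto simp: torus_point_def image_image)
  ultimately have "bounded_functions \<sigma> (torus_point \<sigma> ` tentacle v U) =
      {f \<in> coordinate_ring \<sigma>. \<forall>\<alpha>\<in>Poly_Mapping.keys f. 0 \<le> pairing \<alpha> v}"
    unfolding bounded_functions_def by (intro Collect_cong conj_cong refl) simp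
  also have "\<dots> = semigroup_algebra (lattice_points (dual_cone \<sigma> \<inter> dual_cone (ray v)))"
    by (auto simp: coordinate_ring_def semigroup_algebra_def lattice_points_def
        real_vec_in_dual_cone_ray)
  finally show ?thesis .
qed

end
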